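(* Let $\lambda,\mu>0$ and $x^*\in\Omega$. The following results hold. (i) Suppose $f$ is strongly smooth with constant $L>0$. If $x^*$ is a global minimizer of $\min_{x\in\mathbb{R}^n}\phi(x)$, then for any $\tau>0$ satisfying $\frac1\tau>L$, $x^*$ is a $\tau$-stationary point of this problem. (ii) Suppose that $f$ is convex. Let $x^*$ be a $\tau$-stationary point of $\min_{x\in\mathbb{R}^n}\phi(x)$ for some $\tau>0$. Then $x^*$ is a support optimal (SO) point of $\min_{x\in\mathbb{R}^n}\phi(x)$.
   Context: The index set $\{1,\dots,n\}$ is partitioned into pairwise disjoint groups $G_1,\dots,G_q$ with $\cup_{i=1}^q G_i=\{1,\dots,n\}$, $q\in\{1,\dots,n\}$; $x_{G_i}$ is the sub-vector of $x\in\mathbb{R}^n$ restricted to $G_i$. $\|\cdot\|$ is the Euclidean norm, $\|x\|_0$ is the number of nonzero entries of $x$, $\|x\|_{2,0}$ is the number of indices $i$ with $\|x_{G_i}\|\neq 0$, and $\mathrm{supp}(x)$ is the set of indices of nonzero entries of $x$. The box is $\Omega=\{x\in\mathbb{R}^n : -l\le x\le u\}$ with $l,u\in\mathbb{R}^n$, $l,u\ge 0$; $\delta_\Omega$ is its indicator function ($0$ on $\Omega$, $+\infty$ outside). $f:\mathbb{R}^n\to\mathbb{R}$ is smooth and bounded from below on $\Omega$. Define $p(x)=\lambda\|x\|_0+\mu\|x\|_{2,0}+\delta_\Omega(x)$ and $\phi(x)=f(x)+p(x)$. $f$ is strongly smooth with constant $L>0$ if $f(z)\le f(x)+\langle\nabla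 f(x),z-x\rangle+\frac L2\|z-x\|^2$ for all $x,z\in\mathbb{R}^n$. $\mathrm{Prox}_{\tau p(\cdot)}(s)=\arg\min_{y\in\mathbb{R}^n}\frac12\|y-s\|^2+\tau p(y)$ (a set). A vector $x^*\in\Omega$ is a $\tau$-stationary point of $\min\phi$ if $x^*\in\mathrm{Prox}_{\tau p(\cdot)}(x^*-\tau\nabla f(x^* ))$. A vector $x^*\in\Omega$ is a support optimal (SO) point of $\min\phi$ if $x^*$ is a global minimizer of $\min_{x\in\mathbb{X}}f(x)$, where $\mathbb{X}=\{x\in\Omega : \mathrm{supp}(x)\subseteq\mathrm{supp}(x^* )\}$. *)

theory Defs
  imports "HOL-Analysis.Analysis"
begin

text \<open>
  Vectors of \<open>\<real>\<^sup>n\<close> have type \<^typ>\<open>real ^ 'n\<close>; their order \<open>\<le>\<close> is the componentwise one.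
  The groups \<open>G\<^sub>1, \<dots>, G\<^sub>q\<close> are \<open>G 1, \<dots>, G q\<close> for a family \<open>G :: nat \<Rightarrow> 'n set\<close>; values of
  \<open>G\<close> outside \<open>{1..q}\<close> are irrelevant.  Groups may be empty; an empty group contributes nothing
  to the group norm.
\<close>

definition is_grouping :: "(nat \<Rightarrow> 'n::finite set) \<Rightarrow> nat \<Rightarrow> bool" where
  "is_grouping G q \<longleftrightarrow>
     q \<in> {1..CARD('n)} \<and> disjoint_family_on G {1..q} \<and> (\<Union>i\<in>{1..q}. G i) = UNIV"

definition supp :: "real ^ 'n::finite \<Rightarrow> 'n set" where
  "supp x = {j. x $ j \<noteq> 0}"

definition l0_norm :: "real ^ 'n::finite \<Rightarrow> nat" where
  "l0_norm x = card {j. x $ j \<noteq> 0}"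

text \<open>
  The length of the sub-vector \<open>x\<^bsub>G\<^sub>i\<^esub>\<close> depends on \<open>i\<close>, so it has no type of its own; its
  Euclidean norm is \<open>L2_set\<close> of the coordinates of \<open>x\<close> over the index set \<open>G i\<close>.
\<close>

definition subvector_norm :: "real ^ 'n::finite \<Rightarrow> 'n set \<Rightarrow> real" where
  "subvector_norm x S = L2_set (\<lambda>j. x $ j) S"

definition l20_norm :: "(nat \<Rightarrow> 'n::finite set) \<Rightarrow> nat \<Rightarrow> real ^ 'n \<Rightarrow> nat" where
  "l20_norm G q x = card {i \<in> {1..q}. subvector_norm x (G i) \<noteq> 0}"

definition Box :: "real ^ 'n::finite \<Rightarrow> real ^ 'n \<Rightarrow> (real ^ 'n) set" where
  "Box l u = {x. - l \<le> x \<and> x \<le> u}"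

definition indicator_fun :: "'a set \<Rightarrow> 'a \<Rightarrow> ereal" where
  "indicator_fun S x = (if x \<in> S then 0 else \<infinity>)"

definition p_fun ::
  "real \<Rightarrow> real \<Rightarrow> (nat \<Rightarrow> 'n::finite set) \<Rightarrow> nat \<Rightarrow> real ^ 'n \<Rightarrow> real ^ 'n \<Rightarrow> real ^ 'n \<Rightarrow> ereal" where
  "p_fun lam mu G q l u x =
     ereal (lam * real (l0_norm x) + mu * real (l20_norm G q x)) + indicator_fun (Box l u) x"

definition phi_fun ::
  "(real ^ 'n::finite \<Rightarrow> real) \<Rightarrow> real \<Rightarrow> real \<Rightarrow> (nat \<Rightarrow> 'n set) \<Rightarrow> nat \<Rightarrow> real ^ 'n \<Rightarrow> real ^ 'n
     \<Rightarrow> real ^ 'n \<Rightarrow> ereal" where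
  "phi_fun f lam mu G q l u x = ereal (f x) + p_fun lam mu G q l u x"

text \<open>Smooth is read as continuously differentiable.\<close>

definition smooth_fun :: "('a::real_inner \<Rightarrow> real) \<Rightarrow> bool" where
  "smooth_fun f \<longleftrightarrow> (\<exists>g. continuous_on UNIV g \<and> (\<forall>x. GDERIV f x :> g x))"

text \<open>Only meaningful at points where \<open>f\<close> is differentiable.\<close>

definition grad :: "('a::real_inner \<Rightarrow> real) \<Rightarrow> 'a \<Rightarrow> 'a" where
  "grad f x = (THE g. GDERIV f x :> g)"

lemma grad_eq:
  assumes "GDERIV f x :> g"
  shows "grad f x = g"
  unfolding grad_def
proof (rule the_equality)
  show "GDERIV f x :> g" by fact
next
  fix h assume "GDERIV f x :> h"
  then have "(\<lambda>v. v \<bullet> h) = (\<lambda>v. v \<bullet> g)"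
    using assms unfolding gderiv_def by (rule has_derivative_unique)
  then have "\<forall>v. v \<bullet> h = v \<bullet> g" by metis
  then show "h = g" by (simp add: vector_eq_ldot)
qed

definition strongly_smooth :: "('a::real_inner \<Rightarrow> real) \<Rightarrow> real \<Rightarrow> bool" where
  "strongly_smooth f L \<longleftrightarrow>
     (\<forall>x z. f z \<le> f x + grad f x \<bullet> (z - x) + L / 2 * (norm (z - x))\<^sup>2)"

definition global_minimizer :: "('a \<Rightarrow> 'b::order) \<Rightarrow> 'a set \<Rightarrow> 'a \<Rightarrow> bool" where
  "global_minimizer h S x \<longleftrightarrow> x \<in> S \<and> (\<forall>y\<in>S. h x \<le> h y)"

definition Prox :: "real \<Rightarrow> ('a::real_normed_vector \<Rightarrow> ereal) \<Rightarrow> 'a \<Rightarrow> 'a set" where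
  "Prox \<tau> p s =
     {y. global_minimizer (\<lambda>y. ereal (1 / 2 * (norm (y - s))\<^sup>2) + ereal \<tau> * p y) UNIV y}"

definition tau_stationary ::
  "(real ^ 'n::finite \<Rightarrow> real) \<Rightarrow> real \<Rightarrow> real \<Rightarrow> (nat \<Rightarrow> 'n set) \<Rightarrow> nat \<Rightarrow> real ^ 'n \<Rightarrow> real ^ 'n
     \<Rightarrow> real \<Rightarrow> real ^ 'n \<Rightarrow> bool" where
  "tau_stationary f lam mu G q l u \<tau> x \<longleftrightarrow>
     x \<in> Box l u \<and> x \<in> Prox \<tau> (p_fun lam mu G q l u) (x - \<tau> *\<^sub>R grad f x)"

definition support_optimal ::
  "(real ^ 'n::finite \<Rightarrow> real) \<Rightarrow> real ^ 'n \<Rightarrow> real ^ 'n \<Rightarrow> real ^ 'n \<Rightarrow> bool" where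
  "support_optimal f l u xs \<longleftrightarrow>
     xs \<in> Box l u \<and> global_minimizer f {x \<in> Box l u. supp x \<subseteq> supp xs} xs"

end

theory Submission
  imports Defs
begin

text \<open>
  Expanding the squares, \<open>x\<close> is \<open>\<tau>\<close>-stationary iff, with \<open>d = y - x\<close>,
  \<open>\<tau> r x \<le> \<parallel>d\<parallel>\<^sup>2 / 2 + \<tau> \<langle>\<nabla>f x, d\<rangle> + \<tau> r y\<close> for all \<open>y\<close> in the box, where \<open>r\<close> is the sparsity
  penalty. For (i) this is global optimality combined with the descent inequality. For (ii), shrinking
  the support does not increase \<open>r\<close>, so \<open>\<parallel>d\<parallel>\<^sup>2 / 2 + \<tau> \<langle>\<nabla>f x, d\<rangle> \<ge> 0\<close> whenever the support of \<open>y\<close> lies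
  in that of \<open>x\<close>; replacing \<open>d\<close> by \<open>t d\<close> with \<open>t \<rightarrow> 0\<close> gives \<open>\<langle>\<nabla>f x, d\<rangle> \<ge> 0\<close>, and convexity concludes.
\<close>

text \<open>The finite part of \<open>p_fun\<close>, kept real so that objective values at points of
  the box can be compared by real arithmetic.\<close>

definition sparsity_penalty ::
  "real \<Rightarrow> real \<Rightarrow> (nat \<Rightarrow> 'n::finite set) \<Rightarrow> nat \<Rightarrow> real ^ 'n \<Rightarrow> real" where
  "sparsity_penalty lam mu G q x = lam * real (l0_norm x) + mu * real (l20_norm G q x)"

lemma p_fun_eq:
  "p_fun lam mu G q l u x = (if x \<in> Box l u then ereal (sparsity_penalty lam mu G q x) else \<infinity>)"
  by (simp add: p_fun_def sparsity_penalty_def indicator_fun_def)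

lemma l0_norm_mono: "supp x \<subseteq> supp y \<Longrightarrow> l0_norm x \<le> l0_norm y"
  unfolding l0_norm_def supp_def by (rule card_mono) simp_all

text \<open>Makes the group count depend on the support alone, which is what yields its
  monotonicity.\<close>

lemma subvector_norm_eq_0_iff: "subvector_norm x S = 0 \<longleftrightarrow> supp x \<inter> S = {}"
  by (auto simp: subvector_norm_def supp_def L2_set_eq_0_iff)

lemma l20_norm_mono: "supp x \<subseteq> supp y \<Longrightarrow> l20_norm G q x \<le> l20_norm G q y"
  unfolding l20_norm_def subvector_norm_eq_0_iff by (rule card_mono) auto

lemma sparsity_penalty_mono:
  assumes "0 \<le> lam" "0 \<le> mu" "supp x \<subseteq> supp y"
  shows "sparsity_penalty lam mu G q x \<le> sparsity_penalty lam mu G q y"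
  unfolding sparsity_penalty_def
  using assms by (intro add_mono mult_left_mono) (simp_all add: l0_norm_mono l20_norm_mono)

lemma convex_Box: "convex (Box l u)"
proof -
  have "Box l u = cbox (- l) u"
    by (auto simp: Box_def mem_box_cart less_eq_vec_def)
  then show ?thesis by simp
qed

lemma convex_supp_subset: "convex {x. supp x \<subseteq> S}"
  unfolding convex_def
proof clarsimp
  fix x y :: "real ^ 'a" and a b :: real and j
  assume "supp x \<subseteq> S" "supp y \<subseteq> S" "j \<in> supp (a *\<^sub>R x + b *\<^sub>R y)"
  then show "j \<in> S"
    by (cases "x $ j = 0"; cases "y $ j = 0") (auto simp: supp_def)
qed

lemma tau_stationary_iff:
  assumes "0 < \<tau>"
  shows "tau_stationary f lam mu G q l u \<tau> x \<longleftrightarrow>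
    x \<in> Box l u \<and>
    (\<forall>y\<in>Box l u. \<tau> * sparsity_penalty lam mu G q x \<le>
       (norm (y - x))\<^sup>2 / 2 + \<tau> * (grad f x \<bullet> (y - x)) + \<tau> * sparsity_penalty lam mu G q y)"
proof (cases "x \<in> Box l u")
  case True
  let ?s = "x - \<tau> *\<^sub>R grad f x" and ?r = "sparsity_penalty lam mu G q"
  \<comment> \<open>Only the first two terms vary with \<open>y\<close>, and both vanish at
    \<open>y = x\<close>; the last term cancels when the objective values at \<open>x\<close> and
    \<open>y\<close> are compared.\<close>
  have sq: "(norm (y - ?s))\<^sup>2 = (norm (y - x))\<^sup>2 + 2 * \<tau> * (grad f x \<bullet> (y - x)) + (norm (x - ?s))\<^sup>2" for y
    unfolding power2_norm_eq_inner by (simp add: inner_simps inner_commute algebra_simps)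
  have "1 / 2 * (norm (x - ?s))\<^sup>2 + \<tau> * ?r x \<le> 1 / 2 * (norm (y - ?s))\<^sup>2 + \<tau> * ?r y \<longleftrightarrow>
      \<tau> * ?r x \<le> (norm (y - x))\<^sup>2 / 2 + \<tau> * (grad f x \<bullet> (y - x)) + \<tau> * ?r y" for y
    unfolding sq[of y] by argo
  \<comment> \<open>Outside the box the proximal objective is infinite because \<open>\<tau>\<close>
    is positive, so only competitors in the box matter.\<close>
  moreover have "x \<in> Prox \<tau> (p_fun lam mu G q l u) ?s \<longleftrightarrow>
      (\<forall>y\<in>Box l u. 1 / 2 * (norm (x - ?s))\<^sup>2 + \<tau> * ?r x \<le> 1 / 2 * (norm (y - ?s))\<^sup>2 + \<tau> * ?r y)"
    using assms True by (auto simp: Prox_def global_minimizer_def p_fun_eq)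
  ultimately show ?thesis
    using True by (simp add: tau_stationary_def)
next
  case False
  then show ?thesis by (simp add: tau_stationary_def)
qed

text \<open>Restricting \<open>f\<close> to the line through \<open>x\<close> and \<open>y\<close>
  gives a convex function of one real variable; its tangent at 0, evaluated at 1, is the
  bound.\<close>

lemma convex_on_grad_inequality:
  assumes f: "convex_on UNIV f" and g: "GDERIV f x :> g"
  shows "f x + g \<bullet> (y - x) \<le> f y"
proof -
  define h where "h t = f (x + t *\<^sub>R (y - x))" for t
  have "convex_on UNIV h"
  proof (rule convex_onI)
    fix t a b :: real assume t: "0 < t" "t < 1"
    have "x + ((1 - t) *\<^sub>R a + t *\<^sub>R b) *\<^sub>R (y - x) =
        (1 - t) *\<^sub>R (x + a *\<^sub>R (y - x)) + t *\<^sub>R (x + b *\<^sub>R (y - x))"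
      by (simp add: algebra_simps)
    then show "h ((1 - t) *\<^sub>R a + t *\<^sub>R b) \<le> (1 - t) * h a + t * h b"
      unfolding h_def using convex_onD[OF f] t by simp
  qed simp
  moreover have "(h has_real_derivative g \<bullet> (y - x)) (at 0)"
  proof -
    have "((\<lambda>t. x + t *\<^sub>R (y - x)) has_derivative (\<lambda>t. t *\<^sub>R (y - x))) (at 0)"
      by (auto intro!: derivative_eq_intros)
    moreover have "(f has_derivative (\<lambda>v. v \<bullet> g)) (at (x + 0 *\<^sub>R (y - x)))"
      using g by (simp add: gderiv_def)
    ultimately have "(h has_derivative (\<lambda>t. (t *\<^sub>R (y - x)) \<bullet> g)) (at 0)"
      unfolding h_def by (rule has_derivative_compose)
    then show ?thesis
      by (simp add: has_field_derivative_def inner_commute[of _ g] mult.commute[of _ "g \<bullet> (y - x)"])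
  qed
  ultimately have "h 1 - h 0 \<ge> g \<bullet> (y - x) * (1 - 0)"
    by (intro convex_on_imp_above_tangent[where A = UNIV]) auto
  then show ?thesis by (simp add: h_def)
qed

text \<open>Dividing by the positive \<open>t\<close> leaves \<open>t * a + b\<close>, which tends
  to \<open>b\<close> as \<open>t\<close> decreases to 0.\<close>

lemma nonneg_if_quadratic_nonneg_near_0:
  fixes a b :: real
  assumes "\<And>t. 0 < t \<Longrightarrow> t < 1 \<Longrightarrow> 0 \<le> t\<^sup>2 * a + t * b"
  shows "0 \<le> b"
proof (rule tendsto_lowerbound)
  show "((\<lambda>t. t * a + b) \<longlongrightarrow> b) (at_right 0)"
    by (auto intro!: tendsto_eq_intros)
  have "0 \<le> t * a + b" if "0 < t" "t < 1" for t
  proof -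
    have "0 \<le> t * (t * a + b)"
      using assms[OF that] by (simp add: power2_eq_square algebra_simps)
    with that show ?thesis by (simp add: zero_le_mult_iff)
  qed
  then show "\<forall>\<^sub>F t in at_right 0. 0 \<le> t * a + b"
    by (auto simp: eventually_at_right_field intro!: exI[of _ 1])
qed simp

lemma global_minimizer_imp_tau_stationary:
  assumes smooth: "strongly_smooth f L"
    and min: "global_minimizer (phi_fun f lam mu G q l u) UNIV x"
    and x: "x \<in> Box l u"
    and \<tau>: "0 < \<tau>" "L < 1 / \<tau>"
  shows "tau_stationary f lam mu G q l u \<tau> x"
  unfolding tau_stationary_iff[OF \<tau>(1)]
proof (intro conjI ballI x)
  fix y assume y: "y \<in> Box l u"
  let ?r = "sparsity_penalty lam mu G q" and ?d = "y - x"
  have "phi_fun f lam mu G q l u x \<le> phi_fun f lam mu G q l u y"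
    using min by (simp add: global_minimizer_def)
  then have "f x + ?r x \<le> f y + ?r y"
    using x y by (simp add: phi_fun_def p_fun_eq)
  also have "f y \<le> f x + grad f x \<bullet> ?d + L / 2 * (norm ?d)\<^sup>2"
    using smooth by (simp add: strongly_smooth_def)
  finally have "?r x \<le> L / 2 * (norm ?d)\<^sup>2 + grad f x \<bullet> ?d + ?r y"
    by simp
  then have "\<tau> * ?r x \<le> \<tau> * (L / 2 * (norm ?d)\<^sup>2 + grad f x \<bullet> ?d + ?r y)"
    using \<tau> by (intro mult_left_mono) simp_all
  also have "\<dots> = (\<tau> * L) * ((norm ?d)\<^sup>2 / 2) + \<tau> * (grad f x \<bullet> ?d) + \<tau> * ?r y"
    by (simp add: algebra_simps)
  \<comment> \<open>The step-size condition enters here, as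
    \<open>\<tau> * L \<le> 1\<close>.\<close>
  also have "(\<tau> * L) * ((norm ?d)\<^sup>2 / 2) \<le> 1 * ((norm ?d)\<^sup>2 / 2)"
    using \<tau> by (intro mult_right_mono) (simp_all add: field_simps)
  finally show "\<tau> * ?r x \<le> (norm ?d)\<^sup>2 / 2 + \<tau> * (grad f x \<bullet> ?d) + \<tau> * ?r y"
    by simp
qed

lemma tau_stationary_imp_support_optimal:
  assumes convex: "convex_on UNIV f" and grad: "GDERIV f x :> grad f x"
    and nonneg: "0 \<le> lam" "0 \<le> mu" and \<tau>: "0 < \<tau>"
    and stat: "tau_stationary f lam mu G q l u \<tau> x"
  shows "support_optimal f l u x"
proof -
  let ?X = "{y \<in> Box l u. supp y \<subseteq> supp x}"
  have x: "x \<in> Box l u"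
    using stat by (simp add: tau_stationary_def)
  have "convex ?X"
    using convex_Int[OF convex_Box convex_supp_subset] by (simp add: Int_def)
  have "f x \<le> f y" if y: "y \<in> ?X" for y
  proof -
    let ?d = "y - x"
    have "0 \<le> t\<^sup>2 * ((norm ?d)\<^sup>2 / 2) + t * (\<tau> * (grad f x \<bullet> ?d))" if t: "0 < t" "t < 1" for t
    proof -
      \<comment> \<open>The segment from \<open>x\<close> to \<open>y\<close> stays in the convex
        set \<open>?X\<close>, so the penalty at \<open>?z\<close> is at most that at
        \<open>x\<close> and both drop out of the stationarity inequality.\<close>
      let ?z = "(1 - t) *\<^sub>R x + t *\<^sub>R y"
      have z: "?z \<in> ?X"
        using \<open>convex ?X\<close> x y t by (intro convexD_alt) auto
      then have "\<tau> * sparsity_penalty lam mu G q ?z \<le> \<tau> * sparsity_penalty lam mu G q x"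
        using \<tau> nonneg by (simp add: sparsity_penalty_mono)
      moreover have "\<tau> * sparsity_penalty lam mu G q x \<le> (norm (?z - x))\<^sup>2 / 2
          + \<tau> * (grad f x \<bullet> (?z - x)) + \<tau> * sparsity_penalty lam mu G q ?z"
        using stat z \<tau> by (simp add: tau_stationary_iff)
      ultimately have "0 \<le> (norm (?z - x))\<^sup>2 / 2 + \<tau> * (grad f x \<bullet> (?z - x))"
        by linarith
      moreover have "?z - x = t *\<^sub>R ?d"
        by (simp add: algebra_simps)
      ultimately show ?thesis
        by (simp add: power_mult_distrib mult.left_commute)
    qed
    then have "0 \<le> \<tau> * (grad f x \<bullet> ?d)"
      by (rule nonneg_if_quadratic_nonneg_near_0)
    then have "0 \<le> grad f x \<bullet> ?d"
      using \<tau> by (simp add: zero_le_mult_iff)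
    with convex_on_grad_inequality[OF convex grad, of y] show ?thesis
      by simp
  qed
  with x show ?thesis
    by (simp add: support_optimal_def global_minimizer_def)
qed

text \<open>Smoothness provides some gradient at each point, and uniqueness identifies it with the
  description defining \<open>grad\<close>.\<close>

lemma smooth_fun_GDERIV_grad:
  assumes "smooth_fun f"
  shows "GDERIV f x :> grad f x"
  using assms grad_eq unfolding smooth_fun_def by metis

theorem lemma3p3:
  fixes f :: "real ^ 'n::finite \<Rightarrow> real"
    and G :: "nat \<Rightarrow> 'n set" and q :: nat
    and l u xs :: "real ^ 'n"
    and lam mu :: real
  assumes "is_grouping G q"
    and "0 \<le> l" and "0 \<le> u"
    and "smooth_fun f"
    and "bdd_below (f ` Box l u)"
    and "lam > 0" and "mu > 0"
    and "xs \<in> Box l u"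
  shows
    "(\<forall>L>0. strongly_smooth f L \<longrightarrow>
        global_minimizer (phi_fun f lam mu G q l u) UNIV xs \<longrightarrow>
        (\<forall>\<tau>>0. 1 / \<tau> > L \<longrightarrow> tau_stationary f lam mu G q l u \<tau> xs))
     \<and> (convex_on UNIV f \<longrightarrow>
        (\<exists>\<tau>>0. tau_stationary f lam mu G q l u \<tau> xs) \<longrightarrow>
        support_optimal f l u xs)"
  using assms global_minimizer_imp_tau_stationary
    tau_stationary_imp_support_optimal[OF _ smooth_fun_GDERIV_grad[OF assms(4)]]
  by (metis less_imp_le)

end
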